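(* Let $G_1,G_2$ be connected graphs with $n\ge2$ and $m\ge2$ nodes and algebraic connectivities $\lambda_2^{(1)},\lambda_2^{(2)}$. Let every node of $G_1$ be linked to every node of $G_2$ with the uniform weight $c/(nm)$, $c\ge0$, and let $L$ be the resulting supra-Laplacian. Then $$\lambda_2[L]=\min\left[\left(\frac1n+\frac1m\right)c,\ \ \lambda_2^{(1)}+\frac cn,\ \ \lambda_2^{(2)}+\frac cm\right].$$ Consequently: (Case 1) If $n>m$ and $\lambda_2^{(1)}/n>\lambda_2^{(2)}/m$, then with $c^*=n\lambda_2^{(2)}$ and $c^{**}=\left(\frac1m-\frac1n\right)^{-1}\left(\lambda_2^{(1)}-\lambda_2^{(2)}\right)$ one has $c^*<c^{**}$ and $\lambda_2[L]=(\frac1n+\frac1m)c$ for $0\le c\le c^*$, $\lambda_2[L]=\lambda_2^{(2)}+\frac cm$ for $c^*\le c\le c^{**}$, and $\lambda_2[L]=\lambda_2^{(1)}+\frac cn$ for $c\ge c^{**}$. (Case 2) If $n>m$, $\lambda_2^{(1)}>\lambda_2^{(2)}$ and $\lambda_2^{(1)}/n<\lambda_2^{(2)}/m$, then with $c^*=m\lambda_2^{(1)}$ one has $\lambda_2[L]=(\frac1n+\frac1m)c$ for $0\le c\le c^*$ and $\lambda_2[L]=\lambda_2^{(1)}+\frac cn$ for $c\ge c^*$. (Case 3) If $n<m$ and $\lambda_2^{(1)}>\lambda_2^{(2)}$, then with $c^*=n\lambda_2^{(2)}$ one has $\lambda_2[L]=(\frac1n+\frac1m)c$ for $0\le c\le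 c^*$ and $\lambda_2[L]=\lambda_2^{(2)}+\frac cm$ for $c\ge c^*$. (Equal sizes) If $n=m$, then with $\lambda_2^{(0)}=\min(\lambda_2^{(1)},\lambda_2^{(2)})$ and $c^*=n\lambda_2^{(0)}$ one has $\lambda_2[L]=\frac{2c}n$ for $0\le c\le c^*$ and $\lambda_2[L]=\lambda_2^{(0)}+\frac cn$ for $c\ge c^*$.
   Context: $G_1,G_2$ are finite undirected unweighted connected graphs with Laplacian matrices $L_1$ ($n\times n$) and $L_2$ ($m\times m$). The algebraic connectivity $\lambda_2[\cdot]$ of a Laplacian is its second smallest eigenvalue counted with multiplicity; $\lambda_2^{(k)}=\lambda_2[L_k]$. For a nonnegative $n\times m$ interlayer weight matrix $W$ the supra-Laplacian is $$L=\begin{bmatrix} L_1+\mathrm{diag}(W\boldsymbol 1_m) & -W\\ -W^T & L_2+\mathrm{diag}(W^T\boldsymbol 1_n)\end{bmatrix},$$ with $\boldsymbol 1_k$ the all-ones vector in $\mathbb R^k$; here $W=\frac{c}{nm}\boldsymbol 1_n\boldsymbol 1_m^T$. *)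

theory Defs
  imports
    "Graph_Theory.Pair_Digraph"
    "Graph_Theory.Digraph_Component"
    "Jordan_Normal_Form.Char_Poly"
    "HOL-Computational_Algebra.Polynomial"
begin

text \<open>A finite simple undirected graph is a \<open>pair_graph\<close>: an edge is a pair of opposite arcs, so
  the degree of a vertex is its out-degree. The list \<open>vs\<close> enumerates the vertices, that is, it
  fixes which vertex owns which row and column.\<close>

definition laplacian :: "'a pair_pre_digraph \<Rightarrow> 'a list \<Rightarrow> real mat" where
  "laplacian G vs = mat (length vs) (length vs) (\<lambda>(i, j).
     if i = j then real (out_degree (with_proj G) (vs ! i))
     else if vs ! i \<rightarrow>\<^bsub>with_proj G\<^esub> vs ! j then - 1 else 0)"

definition vertex_enum :: "'a pair_pre_digraph \<Rightarrow> 'a list \<Rightarrow> bool" where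
  "vertex_enum G vs \<longleftrightarrow> distinct vs \<and> set vs = pverts G"

text \<open>The real eigenvalues in increasing order, repeated according to algebraic multiplicity. For
  a real symmetric matrix, such as a Laplacian, this list contains all eigenvalues, and algebraic
  and geometric multiplicities agree.\<close>

definition eigenvalue_list :: "real mat \<Rightarrow> real list" where
  "eigenvalue_list A = sorted_list_of_multiset (proots (char_poly A))"

definition algebraic_connectivity :: "real mat \<Rightarrow> real" where
  "algebraic_connectivity A = eigenvalue_list A ! 1"

definition ones_vec :: "nat \<Rightarrow> real vec" where
  "ones_vec k = vec k (\<lambda>_. 1)"

definition diag_of_vec :: "real vec \<Rightarrow> real mat" where
  "diag_of_vec v = mat_diag (dim_vec v) (\<lambda>i. v $ i)"

definition supra_laplacian :: "real mat \<Rightarrow> real mat \<Rightarrow> real mat \<Rightarrow> real mat" where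
  "supra_laplacian L1 L2 W = four_block_mat
     (L1 + diag_of_vec (W *\<^sub>v ones_vec (dim_col W))) (- W)
     (- transpose_mat W) (L2 + diag_of_vec (transpose_mat W *\<^sub>v ones_vec (dim_row W)))"

definition uniform_coupling :: "nat \<Rightarrow> nat \<Rightarrow> real \<Rightarrow> real mat" where
  "uniform_coupling n m c = mat n m (\<lambda>_. c / (real n * real m))"

end

(* Since L1 and L2 annihilate the all-ones vector and the coupling is a multiple of the all-ones
   matrix, a Schur complement and the rank-one determinant det (I - s J) = 1 - n s give, with
   y = x - c/n and z = x - c/m,
     y z det (x I - L) = x (x - (1/n + 1/m) c) det (y I - L1) det (z I - L2).
   Cancelling the eigenvalue 0 of L1 and of L2, the spectrum of L consists of 0, (1/n + 1/m) c, the
   remaining eigenvalues of L1 shifted by c/n and those of L2 shifted by c/m. As Laplacian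
   eigenvalues are real and nonnegative, the second smallest one is the stated minimum. *)
theory Submission
  imports Defs
begin

section \<open>Determinants: Schur complements and constant matrices\<close>

definition const_mat :: "nat \<Rightarrow> nat \<Rightarrow> 'a \<Rightarrow> 'a mat" where
  "const_mat n m t = mat n m (\<lambda>_. t)"

lemma const_mat_carrier [simp]: "const_mat n m t \<in> carrier_mat n m"
  and const_mat_index [simp]: "i < n \<Longrightarrow> j < m \<Longrightarrow> const_mat n m t $$ (i, j) = t"
  and const_mat_dim [simp]: "dim_row (const_mat n m t) = n" "dim_col (const_mat n m t) = m"
  by (auto simp: const_mat_def)

lemma const_mat_mult:
  "const_mat n m s * const_mat m k t = const_mat n k (of_nat m * s * (t :: 'a :: comm_semiring_1))"
  by (rule eq_matI) (auto simp: scalar_prod_def mult.assoc)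

lemma minus_add_cancel_mat:
  fixes A :: "'a :: ab_group_add mat"
  assumes "A \<in> carrier_mat n m" "B \<in> carrier_mat n m"
  shows "A - B + B = A" "B + (A - B) = A"
  by (rule eq_matI; use assms in simp)+

text \<open>The block matrix is an upper block triangular matrix times a lower unitriangular one.
  Giving the lower left block as \<open>D * K\<close> lets \<open>K\<close> play the role of D^(-1)
  C, so no inverse appears and \<open>D\<close> may be singular.\<close>

lemma det_schur_lower_right:
  fixes A :: "'a :: idom mat"
  assumes A: "A \<in> carrier_mat n n" and B: "B \<in> carrier_mat n m"
    and D: "D \<in> carrier_mat m m" and K: "K \<in> carrier_mat m n"
  shows "det (four_block_mat A B (D * K) D) = det (A - B * K) * det D"
proof -
  let ?U = "four_block_mat (A - B * K) B (0\<^sub>m m n) D"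
  let ?V = "four_block_mat (1\<^sub>m n) (0\<^sub>m n m) K (1\<^sub>m m)"
  have BK: "B * K \<in> carrier_mat n n" using B K by simp
  then have S: "A - B * K \<in> carrier_mat n n" by (rule minus_carrier_mat)
  have "?U * ?V = four_block_mat ((A - B * K) * 1\<^sub>m n + B * K) ((A - B * K) * 0\<^sub>m n m + B * 1\<^sub>m m)
      (0\<^sub>m m n * 1\<^sub>m n + D * K) (0\<^sub>m m n * 0\<^sub>m n m + D * 1\<^sub>m m)"
    by (rule mult_four_block_mat[OF S B _ D _ zero_carrier_mat K one_carrier_mat]) simp_all
  also have "\<dots> = four_block_mat A B (D * K) D"
    using B D K S by (simp add: minus_add_cancel_mat(1)[OF A BK])
  finally have "det (four_block_mat A B (D * K) D) = det (?U * ?V)" by (rule sym[OF arg_cong])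
  also have "\<dots> = det ?U * det ?V"
    by (rule det_mult[OF four_block_carrier_mat[OF S D] four_block_carrier_mat]) simp_all
  also have "det ?U = det (A - B * K) * det D"
    by (rule det_four_block_mat_lower_left_zero[OF S B refl D])
  also have "det ?V = det (1\<^sub>m n) * det (1\<^sub>m m)"
    by (rule det_four_block_mat_upper_right_zero[OF _ refl K]) simp_all
  finally show ?thesis by simp
qed

text \<open>Mirror image of the previous factorization: elimination goes through \<open>A\<close>,
  with the upper right block given as \<open>A * K\<close>.\<close>

lemma det_schur_upper_left:
  fixes A :: "'a :: idom mat"
  assumes A: "A \<in> carrier_mat n n" and C: "C \<in> carrier_mat m n"
    and D: "D \<in> carrier_mat m m" and K: "K \<in> carrier_mat n m"
  shows "det (four_block_mat A (A * K) C D) = det A * det (D - C * K)"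
proof -
  let ?U = "four_block_mat A (0\<^sub>m n m) C (D - C * K)"
  let ?V = "four_block_mat (1\<^sub>m n) K (0\<^sub>m m n) (1\<^sub>m m)"
  have CK: "C * K \<in> carrier_mat m m" using C K by simp
  then have S: "D - C * K \<in> carrier_mat m m" by (rule minus_carrier_mat)
  have "?U * ?V = four_block_mat (A * 1\<^sub>m n + 0\<^sub>m n m * 0\<^sub>m m n) (A * K + 0\<^sub>m n m * 1\<^sub>m m)
      (C * 1\<^sub>m n + (D - C * K) * 0\<^sub>m m n) (C * K + (D - C * K) * 1\<^sub>m m)"
    by (rule mult_four_block_mat[OF A _ C S one_carrier_mat K zero_carrier_mat]) simp_all
  also have "\<dots> = four_block_mat A (A * K) C D"
    using A C K S by (simp add: minus_add_cancel_mat(2)[OF D CK])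
  finally have "det (four_block_mat A (A * K) C D) = det (?U * ?V)" by (rule sym[OF arg_cong])
  also have "\<dots> = det ?U * det ?V"
    by (rule det_mult[OF four_block_carrier_mat[OF A S] four_block_carrier_mat]) simp_all
  also have "det ?U = det A * det (D - C * K)"
    by (rule det_four_block_mat_upper_right_zero[OF A refl C S])
  also have "det ?V = det (1\<^sub>m n) * det (1\<^sub>m m)"
    by (rule det_four_block_mat_lower_left_zero[OF _ K refl]) simp_all
  finally show ?thesis by simp
qed

text \<open>Sylvester's determinant identity: a constant matrix is a column times a row, and the two
  Schur complements of one bordered matrix of size n + 1 reduce the n by n determinant to a 1 by 1
  one.\<close>

lemma det_one_minus_const_mat:
  "det (1\<^sub>m n - const_mat n n (s :: 'a :: idom)) = 1 - of_nat n * s"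
proof -
  have "det (1\<^sub>m n - const_mat n n s) =
      det (four_block_mat (1\<^sub>m n) (const_mat n 1 s) (const_mat 1 n 1) (1\<^sub>m 1))"
    using det_schur_lower_right[of "1\<^sub>m n" n "const_mat n 1 s" 1 "1\<^sub>m 1" "const_mat 1 n 1"]
    by (simp add: const_mat_mult)
  also have "\<dots> = det (1\<^sub>m 1 - const_mat 1 1 (of_nat n * s))"
    using det_schur_upper_left[of "1\<^sub>m n" n "const_mat 1 n 1" 1 "1\<^sub>m 1" "const_mat n 1 s"]
    by (simp add: const_mat_mult)
  also have "\<dots> = 1 - of_nat n * s"
    by (subst det_single) auto
  finally show ?thesis .
qed

section \<open>Characteristic polynomials and spectra of Laplacians\<close>

lemma poly_char_poly:
  assumes "(A :: 'a :: field mat) \<in> carrier_mat n n"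
  shows "poly (char_poly A) x = det (x \<cdot>\<^sub>m 1\<^sub>m n - A)"
proof -
  have "- char_matrix A x = x \<cdot>\<^sub>m 1\<^sub>m n - A"
    by (rule eq_matI) (use assms in \<open>auto simp: char_matrix_def\<close>)
  then show ?thesis by (simp add: char_poly_matrix[OF assms])
qed

text \<open>Collects the properties that yield a real nonnegative spectrum and a constant kernel
  vector. By the zero row sums, the diagonal holds the weighted degrees.\<close>

definition weighted_laplacian :: "nat \<Rightarrow> real mat \<Rightarrow> bool" where
  "weighted_laplacian n A \<longleftrightarrow> A \<in> carrier_mat n n
     \<and> (\<forall>i<n. \<forall>j<n. A $$ (i, j) = A $$ (j, i))
     \<and> (\<forall>i<n. \<forall>j<n. i \<noteq> j \<longrightarrow> A $$ (i, j) \<le> 0)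
     \<and> (\<forall>i<n. (\<Sum>j<n. A $$ (i, j)) = 0)"

lemma weighted_laplacianD:
  assumes "weighted_laplacian n A"
  shows "A \<in> carrier_mat n n"
    and "i < n \<Longrightarrow> j < n \<Longrightarrow> A $$ (i, j) = A $$ (j, i)"
    and "i < n \<Longrightarrow> j < n \<Longrightarrow> i \<noteq> j \<Longrightarrow> A $$ (i, j) \<le> 0"
    and "i < n \<Longrightarrow> (\<Sum>j<n. A $$ (i, j)) = 0"
  using assms unfolding weighted_laplacian_def by blast+

lemma weighted_laplacian_laplacian:
  assumes "pair_graph G" "vertex_enum G vs"
  shows "weighted_laplacian (length vs) (laplacian G vs)"
proof -
  interpret pair_graph G by fact
  have d: "distinct vs" and s: "set vs = pverts G"
    using assms(2) by (auto simp: vertex_enum_def)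
  have sym: "(u, v) \<in> parcs G \<longleftrightarrow> (v, u) \<in> parcs G" for u v
    using pair_sym_arcs by (auto simp: symmetric_def sym_def)
  have loop: "(u, u) \<notin> parcs G" for u
    using pair_no_loops[of "(u, u)"] by auto
  have row: "(\<Sum>j<length vs. laplacian G vs $$ (i, j)) = 0" if i: "i < length vs" for i
  proof -
    let ?N = "{j. j < length vs \<and> (vs ! i, vs ! j) \<in> parcs G}"
    \<comment> \<open>Positions of neighbours correspond to outgoing arcs: distinctness of
      \<open>vs\<close> gives injectivity, \<open>set vs = pverts G\<close> surjectivity.\<close>
    have "bij_betw (\<lambda>j. (vs ! i, vs ! j)) ?N {e \<in> parcs G. fst e = vs ! i}"
    proof (rule bij_betwI')
      show "(vs ! i, vs ! j) = (vs ! i, vs ! k) \<longleftrightarrow> j = k" if "j \<in> ?N" "k \<in> ?N" for j k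
        using that d by (auto simp: nth_eq_iff_index_eq)
      show "\<exists>j\<in>?N. e = (vs ! i, vs ! j)" if "e \<in> {e \<in> parcs G. fst e = vs ! i}" for e
      proof -
        have "snd e \<in> set vs" using that arc_snd_in_verts s by auto
        then obtain j where "j < length vs" "vs ! j = snd e" by (auto simp: in_set_conv_nth)
        with that show ?thesis by (intro bexI[of _ j]) (cases e, auto)+
      qed
    qed auto
    then have deg: "out_degree (with_proj G) (vs ! i) = card ?N"
      by (simp add: out_degree_def out_arcs_def bij_betw_same_card)
    \<comment> \<open>Each entry is a degree part minus an adjacency indicator; the indicator
      vanishes on the diagonal because there are no loops.\<close>
    have "(\<Sum>j<length vs. laplacian G vs $$ (i, j))
        = (\<Sum>j<length vs. (if j = i then real (out_degree (with_proj G) (vs ! i)) else 0)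
            - (if (vs ! i, vs ! j) \<in> parcs G then 1 else 0))"
      by (rule sum.cong) (use i loop in \<open>auto simp: laplacian_def\<close>)
    also have "\<dots> = real (card ?N) - (\<Sum>j<length vs. if (vs ! i, vs ! j) \<in> parcs G then 1 else 0)"
      using i by (simp add: sum_subtractf deg)
    also have "(\<Sum>j<length vs. if (vs ! i, vs ! j) \<in> parcs G then 1 else 0) = real (card ?N)"
      by (subst sum.inter_filter[symmetric]) auto
    finally show ?thesis by simp
  qed
  then show ?thesis
    unfolding weighted_laplacian_def
    using sym by (auto simp: laplacian_def)
qed

text \<open>The Hermitian form of a real symmetric matrix takes real values, and at an eigenvector
  it equals the eigenvalue times the nonzero squared norm.\<close>

lemma eigenvalue_symmetric_real:
  fixes A :: "real mat" and k :: complex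
  assumes A: "A \<in> carrier_mat n n" and sym: "\<And>i j. i < n \<Longrightarrow> j < n \<Longrightarrow> A $$ (i, j) = A $$ (j, i)"
    and ev: "eigenvalue (map_mat complex_of_real A) k"
  shows "k \<in> \<real>"
proof -
  obtain v where v: "v \<in> carrier_vec n" "v \<noteq> 0\<^sub>v n"
    and Av: "map_mat complex_of_real A *\<^sub>v v = k \<cdot>\<^sub>v v"
    using ev A by (auto simp: eigenvalue_def eigenvector_def)
  have Avi: "(\<Sum>j<n. of_real (A $$ (i, j)) * v $ j) = k * v $ i" if "i < n" for i
    using arg_cong[OF Av, of "\<lambda>w. w $ i"] that A v
    by (simp add: scalar_prod_def lessThan_atLeast0)
  define q where "q = (\<Sum>i<n. \<Sum>j<n. of_real (A $$ (i, j)) * (cnj (v $ i) * v $ j))"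
  define N where "N = (\<Sum>i<n. (cmod (v $ i))\<^sup>2)"
  have "q = (\<Sum>i<n. cnj (v $ i) * (\<Sum>j<n. of_real (A $$ (i, j)) * v $ j))"
    unfolding q_def by (simp add: sum_distrib_left mult_ac)
  also have "\<dots> = (\<Sum>i<n. k * of_real ((cmod (v $ i))\<^sup>2))"
    by (intro sum.cong) (simp_all only: Avi lessThan_iff complex_norm_square, simp add: mult_ac)
  also have "\<dots> = k * of_real N"
    by (simp add: N_def sum_distrib_left)
  finally have q: "q = k * of_real N" .
  \<comment> \<open>After symmetry of \<open>A\<close> is used, conjugation has only interchanged
    \<open>i\<close> and \<open>j\<close>, which swapping the order of summation undoes.\<close>
  have "cnj q = (\<Sum>i<n. \<Sum>j<n. of_real (A $$ (j, i)) * (cnj (v $ j) * v $ i))"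
    unfolding q_def by (simp add: sym mult_ac)
  also have "\<dots> = q"
    unfolding q_def by (rule sum.swap)
  finally have "q \<in> \<real>" by (simp add: Reals_cnj_iff)
  moreover have "N \<noteq> 0"
  proof
    assume "N = 0"
    then have "\<forall>i<n. v $ i = 0" by (simp add: N_def sum_nonneg_eq_0_iff)
    with v show False by (metis carrier_vecD eq_vecI index_zero_vec)
  qed
  ultimately have "q / of_real N \<in> \<real>" by (intro Reals_divide) auto
  with q \<open>N \<noteq> 0\<close> show ?thesis by simp
qed

text \<open>Over the complex numbers the polynomial splits, its roots are real by the previous
  lemma, and the injective embedding of the reals pulls the factorization back.\<close>

lemma char_poly_symmetric_splits:
  fixes A :: "real mat"
  assumes A: "A \<in> carrier_mat n n" and sym: "\<And>i j. i < n \<Longrightarrow> j < n \<Longrightarrow> A $$ (i, j) = A $$ (j, i)"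
  obtains bs where "char_poly A = (\<Prod>b\<leftarrow>bs. [:- b, 1:])" "length bs = n"
proof -
  let ?A = "map_mat complex_of_real A"
  have cA: "?A \<in> carrier_mat n n" using A by simp
  obtain as where as: "char_poly ?A = (\<Prod>a\<leftarrow>as. [:- a, 1:])" "length as = n"
    using char_poly_factorized[OF cA] by blast
  have "a \<in> \<real>" if "a \<in> set as" for a
  proof -
    have "poly (char_poly ?A) a = 0"
      using that unfolding as(1) by (rule linear_poly_root)
    then show ?thesis
      using eigenvalue_symmetric_real[OF A sym] eigenvalue_root_char_poly[OF cA] by blast
  qed
  then have re: "map (\<lambda>b. complex_of_real (Re b)) as = as"
    by (intro map_idI) auto
  define bs where "bs = map Re as"
  interpret h: map_poly_inj_idom_hom complex_of_real ..
  have "map_poly complex_of_real (char_poly A) = char_poly ?A"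
    by (rule of_real_hom.char_poly_hom[OF A, symmetric])
  also have "\<dots> = (\<Prod>a\<leftarrow>map (\<lambda>b. complex_of_real (Re b)) as. [:- a, 1:])"
    by (simp add: as re)
  also have "\<dots> = map_poly complex_of_real (\<Prod>b\<leftarrow>bs. [:- b, 1:])"
    by (simp add: bs_def h.hom_prod_list o_def)
  finally have "char_poly A = (\<Prod>b\<leftarrow>bs. [:- b, 1:])" by simp
  with as(2) that[of bs] show ?thesis by (simp add: bs_def)
qed

text \<open>Maximum principle: at a coordinate \<open>i\<close> where an eigenvector has largest
  modulus, row \<open>i\<close> of the eigenvalue equation writes k v_i^2 as a sum of nonnegative
  terms.\<close>

lemma weighted_laplacian_eigenvalue_nonneg:
  assumes L: "weighted_laplacian n A" and ev: "eigenvalue A k"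
  shows "0 \<le> k"
proof -
  have A: "A \<in> carrier_mat n n" using L by (rule weighted_laplacianD)
  obtain v where v: "v \<in> carrier_vec n" "v \<noteq> 0\<^sub>v n" and Av: "A *\<^sub>v v = k \<cdot>\<^sub>v v"
    using ev A by (auto simp: eigenvalue_def eigenvector_def)
  obtain p where p: "p < n" "v $ p \<noteq> 0"
    using v by (metis carrier_vecD eq_vecI index_zero_vec)
  have "Max ((\<lambda>i. \<bar>v $ i\<bar>) ` {..<n}) \<in> (\<lambda>i. \<bar>v $ i\<bar>) ` {..<n}"
    using p(1) by (intro Max_in) auto
  then obtain i where i: "i < n" and Max: "Max ((\<lambda>i. \<bar>v $ i\<bar>) ` {..<n}) = \<bar>v $ i\<bar>"
    by auto
  have max: "\<bar>v $ j\<bar> \<le> \<bar>v $ i\<bar>" if "j < n" for j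
    unfolding Max[symmetric] using that by (intro Max_ge) auto
  have vi: "v $ i \<noteq> 0" using max[OF p(1)] p(2) by auto
  have "k * v $ i = (\<Sum>j<n. A $$ (i, j) * v $ j)"
    using arg_cong[OF Av, of "\<lambda>w. w $ i"] i A v
    by (simp add: scalar_prod_def lessThan_atLeast0)
  \<comment> \<open>Subtracting the vanishing row sum times \<open>v $ i\<close> produces
    differences \<open>v $ j - v $ i\<close>. By maximality each is zero or opposite in sign to
    \<open>v $ i\<close>.\<close>
  also have "\<dots> = (\<Sum>j<n. A $$ (i, j) * v $ j) - (\<Sum>j<n. A $$ (i, j)) * v $ i"
  proof -
    have "(\<Sum>j<n. A $$ (i, j)) = 0" using L i by (rule weighted_laplacianD)
    then show ?thesis by simp
  qed
  also have "\<dots> = (\<Sum>j<n. A $$ (i, j) * (v $ j - v $ i))"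
    by (simp add: sum_distrib_right right_diff_distrib sum_subtractf)
  finally have "k * v $ i * v $ i = (\<Sum>j<n. A $$ (i, j) * (v $ j - v $ i)) * v $ i"
    by (simp only:)
  then have "k * (v $ i * v $ i) = (\<Sum>j<n. A $$ (i, j) * ((v $ j - v $ i) * v $ i))"
    by (simp only: sum_distrib_right mult.assoc)
  also have "\<dots> \<ge> 0"
  proof (rule sum_nonneg)
    fix j assume j: "j \<in> {..<n}"
    show "0 \<le> A $$ (i, j) * ((v $ j - v $ i) * v $ i)"
    proof (cases "i = j")
      case False
      then have "A $$ (i, j) \<le> 0" using weighted_laplacianD(3)[OF L i] j by simp
      moreover have "(v $ j - v $ i) * v $ i \<le> 0"
        using max[of j] j by (auto simp: mult_le_0_iff abs_if split: if_splits)
      ultimately show ?thesis by (rule mult_nonpos_nonpos)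
    qed simp
  qed
  finally show ?thesis using vi
    by (metis mult_less_0_iff not_less not_real_square_gt_zero)
qed

text \<open>Vanishing row sums make constant columns eigenvectors for \<open>y\<close>. Division by
  \<open>y\<close> thereby replaces matrix inversion in the Schur complements below.\<close>

lemma weighted_laplacian_mult_const_mat:
  assumes "weighted_laplacian n A"
  shows "(y \<cdot>\<^sub>m 1\<^sub>m n - A) * const_mat n m t = const_mat n m (y * t)"
proof (rule eq_matI)
  fix i j assume ij: "i < dim_row (const_mat n m (y * t))" "j < dim_col (const_mat n m (y * t))"
  have A: "A \<in> carrier_mat n n" using assms by (rule weighted_laplacianD)
  have "((y \<cdot>\<^sub>m 1\<^sub>m n - A) * const_mat n m t) $$ (i, j)
      = (\<Sum>l<n. ((if i = l then y else 0) - A $$ (i, l)) * t)"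
    using ij A by (auto simp: scalar_prod_def lessThan_atLeast0 intro!: sum.cong)
  also have "\<dots> = (y - (\<Sum>l<n. A $$ (i, l))) * t"
    using ij by (simp add: sum_subtractf flip: sum_distrib_right)
  also have "(\<Sum>l<n. A $$ (i, l)) = 0"
    using weighted_laplacianD(4)[OF assms] ij by simp
  finally show "((y \<cdot>\<^sub>m 1\<^sub>m n - A) * const_mat n m t) $$ (i, j) = const_mat n m (y * t) $$ (i, j)"
    using ij by simp
qed (use weighted_laplacianD(1)[OF assms] in auto)

text \<open>The all-ones eigenvector accounts for the factor split off. Only one occurrence of 0 is
  removed, so \<open>bs\<close> keeps any further zeros and lists the rest of the spectrum with
  multiplicity.\<close>

lemma weighted_laplacian_char_poly:
  assumes L: "weighted_laplacian n A" and n: "n \<ge> 1"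
  obtains bs where "char_poly A = [:0, 1:] * (\<Prod>b\<leftarrow>bs. [:- b, 1:])"
    "\<And>b. b \<in> set bs \<Longrightarrow> 0 \<le> b" "length bs = n - 1"
proof -
  have A: "A \<in> carrier_mat n n" using L by (rule weighted_laplacianD)
  obtain bs where bs: "char_poly A = (\<Prod>b\<leftarrow>bs. [:- b, 1:])" "length bs = n"
    using char_poly_symmetric_splits[OF A weighted_laplacianD(2)[OF L]] .
  have root: "poly (char_poly A) b = 0 \<longleftrightarrow> b \<in> set bs" for b
    by (auto simp: bs(1) poly_prod_list)
  have "A *\<^sub>v ones_vec n = 0 \<cdot>\<^sub>v ones_vec n"
    by (rule eq_vecI)
      (use A weighted_laplacianD(4)[OF L] in
        \<open>auto simp: ones_vec_def scalar_prod_def lessThan_atLeast0\<close>)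
  moreover have "ones_vec n \<noteq> 0\<^sub>v n"
  proof
    assume "ones_vec n = 0\<^sub>v n"
    then have "ones_vec n $ 0 = 0\<^sub>v n $ 0" by simp
    then show False using n by (simp add: ones_vec_def)
  qed
  ultimately have "eigenvalue A 0"
    using A unfolding eigenvalue_def eigenvector_def
    by (intro exI[of _ "ones_vec n"]) (simp add: ones_vec_def)
  then have zero: "0 \<in> set bs"
    by (simp only: eigenvalue_root_char_poly[OF A] root)
  have nonneg: "0 \<le> b" if "b \<in> set bs" for b
    using that unfolding root[symmetric] eigenvalue_root_char_poly[OF A, symmetric]
    by (rule weighted_laplacian_eigenvalue_nonneg[OF L])
  have "char_poly A = [:0, 1:] * (\<Prod>b\<leftarrow>remove1 0 bs. [:- b, 1:])"
    using prod_list_map_remove1[OF zero, of "\<lambda>b. [:- b, 1:]"] by (simp only: bs(1) minus_zero)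
  moreover have "0 \<le> b" if "b \<in> set (remove1 0 bs)" for b
    by (rule nonneg) (use that set_remove1_subset[of 0 bs] in blast)
  moreover have "length (remove1 0 bs) = n - 1"
    using zero by (simp add: length_remove1 bs(2))
  ultimately show ?thesis by (rule that)
qed

section \<open>Reading the second smallest eigenvalue off a factorization\<close>

lemma proots_prod_linear_factors:
  "proots (\<Prod>b\<leftarrow>bs. [:- b, 1 :: 'a :: idom:]) = mset bs"
proof (induction bs)
  case (Cons b bs)
  have "(\<Prod>b\<leftarrow>bs. [:- b, 1:]) \<noteq> 0" by auto
  then have "proots ([:- b, 1:] * (\<Prod>b\<leftarrow>bs. [:- b, 1:])) = {#b#} + proots (\<Prod>b\<leftarrow>bs. [:- b, 1:])"
    by (subst proots_mult) auto
  with Cons show ?case by simp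
qed simp

text \<open>Nonnegativity puts the split-off 0 first in the sorted list, so its entry at index 1 is
  the head of \<open>sort bs\<close>.\<close>

lemma algebraic_connectivity_eq_Min:
  assumes "char_poly A = [:0, 1:] * (\<Prod>b\<leftarrow>bs. [:- b, 1:])"
    and nonneg: "\<And>b. b \<in> set bs \<Longrightarrow> 0 \<le> b" and ne: "bs \<noteq> []"
  shows "algebraic_connectivity A = Min (set bs)"
proof -
  have "proots (char_poly A) = mset (0 # bs)"
    using proots_prod_linear_factors[of "0 # bs"] assms(1) by simp
  then have "eigenvalue_list A = sort (0 # bs)"
    by (simp only: eigenvalue_list_def sorted_list_of_multiset_mset)
  also have "\<dots> = 0 # sort bs"
    using nonneg by (simp add: insort_is_Cons)
  finally have "algebraic_connectivity A = sort bs ! 0"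
    by (simp add: algebraic_connectivity_def)
  also have "\<dots> = Min (set bs)"
  proof (cases "sort bs")
    case Nil
    with ne show ?thesis by (metis set_empty set_sort)
  next
    case (Cons b xs)
    then have "set bs = insert b (set xs)" "sorted (b # xs)"
      by (metis list.simps(15) set_sort, metis sorted_sort)
    then show ?thesis using Cons by (auto intro!: Min_eqI[symmetric])
  qed
  finally show ?thesis .
qed

section \<open>Characteristic polynomial of the supra-Laplacian\<close>

lemma supra_laplacian_uniform_coupling:
  assumes L1: "L1 \<in> carrier_mat n n" and L2: "L2 \<in> carrier_mat m m" and nm: "n \<ge> 1" "m \<ge> 1"
  shows "supra_laplacian L1 L2 (uniform_coupling n m c) = four_block_mat
    (L1 + (c / n) \<cdot>\<^sub>m 1\<^sub>m n) (- const_mat n m (c / (n * m)))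
    (- const_mat m n (c / (n * m))) (L2 + (c / m) \<cdot>\<^sub>m 1\<^sub>m m)"
  \<comment> \<open>The coupling matrix has all row sums c/n and all column sums c/m, so both
    diagonal corrections are scalar matrices.\<close>
  unfolding supra_laplacian_def
  by (intro arg_cong4[where f = four_block_mat] eq_matI)
    (use assms in \<open>auto simp: uniform_coupling_def diag_of_vec_def mat_diag_def ones_vec_def
       scalar_prod_def\<close>)

text \<open>The Schur complement of the second block differs from \<open>P\<close> by a constant
  matrix, so the coupling contributes only a scalar factor. Excluding y = 0 and z = 0 permits the
  divisions, even where \<open>P\<close> or \<open>Q\<close> is singular.\<close>

lemma poly_char_poly_supra_laplacian:
  fixes n m :: nat and c x :: real
  assumes L1: "weighted_laplacian n L1" and L2: "weighted_laplacian m L2"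
    and nm: "n \<ge> 1" "m \<ge> 1" and y: "y = x - c / n" "y \<noteq> 0" and z: "z = x - c / m" "z \<noteq> 0"
  shows "y * z * poly (char_poly (supra_laplacian L1 L2 (uniform_coupling n m c))) x
    = x * (x - (1 / n + 1 / m) * c) * poly (char_poly L1) y * poly (char_poly L2) z"
proof -
  have c1: "L1 \<in> carrier_mat n n" and c2: "L2 \<in> carrier_mat m m"
    using L1 L2 by (auto dest: weighted_laplacianD(1))
  define a where "a = c / (n * m)"
  define P where "P = y \<cdot>\<^sub>m 1\<^sub>m n - L1"
  define Q where "Q = z \<cdot>\<^sub>m 1\<^sub>m m - L2"
  have P: "P \<in> carrier_mat n n" and Q: "Q \<in> carrier_mat m m"
    using c1 c2 by (auto simp: P_def Q_def)
  let ?M = "supra_laplacian L1 L2 (uniform_coupling n m c)"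
  note M = supra_laplacian_uniform_coupling[OF c1 c2 nm, of c, folded a_def]
  have cM: "?M \<in> carrier_mat (n + m) (n + m)"
    unfolding M using c1 c2 by auto
  have "x \<cdot>\<^sub>m 1\<^sub>m (n + m) - ?M = four_block_mat P (const_mat n m a) (const_mat m n a) Q"
    unfolding M by (rule eq_matI) (use c1 c2 in \<open>auto simp: P_def Q_def y z\<close>)
  \<comment> \<open>\<open>Q\<close> multiplies constant columns by \<open>z\<close>, so entries
    \<open>a / z\<close> give the factor \<open>K\<close> that the Schur complement lemma asks
    for.\<close>
  also have "const_mat m n a = Q * const_mat m n (a / z)"
    using z by (simp add: Q_def weighted_laplacian_mult_const_mat[OF L2])
  finally have "poly (char_poly ?M) x
      = det (P - const_mat n m a * const_mat m n (a / z)) * det Q"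
    by (simp add: poly_char_poly[OF cM] det_schur_lower_right[OF P _ Q])
  \<comment> \<open>A constant matrix with n rows is \<open>P\<close> times itself divided by
    \<open>y\<close>, so \<open>P\<close> factors out and leaves the identity minus a constant
    matrix.\<close>
  also have "P - const_mat n m a * const_mat m n (a / z)
      = P * (1\<^sub>m n - const_mat n n (m * a * a / z / y))"
  proof -
    have "P * (1\<^sub>m n - const_mat n n (m * a * a / z / y))
        = P * 1\<^sub>m n - P * const_mat n n (m * a * a / z / y)"
      by (rule mult_minus_distrib_mat[OF P]) auto
    then show ?thesis
      using P \<open>y \<noteq> 0\<close>
      by (simp add: const_mat_mult weighted_laplacian_mult_const_mat[OF L1, of y, folded P_def])
  qed
  also have "det \<dots> = det P * (1 - n * (m * a * a / z / y))"
    using det_one_minus_const_mat[of n "m * a * a / z / y"]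
    by (subst det_mult[OF P]) auto
  also have "det P = poly (char_poly L1) y"
    by (simp add: poly_char_poly[OF c1] P_def)
  also have "det Q = poly (char_poly L2) z"
    by (simp add: poly_char_poly[OF c2] Q_def)
  finally have "y * z * poly (char_poly ?M) x
      = (y * z - n * m * a * a) * poly (char_poly L1) y * poly (char_poly L2) z"
    using y(2) z(2) by (simp add: field_simps)
  \<comment> \<open>Here n m a^2 is c^2/(nm), which cancels the constant term of
    \<open>y * z\<close> as a polynomial in \<open>x\<close>.\<close>
  also have "y * z - n * m * a * a = x * (x - (1 / n + 1 / m) * c)"
    unfolding y(1) z(1) a_def using nm by (simp add: field_simps)
  finally show ?thesis .
qed

lemma poly_prod_linear_factors_shift:
  "poly (\<Prod>b\<leftarrow>map (\<lambda>b. b + t) bs. [:- b, 1:]) x = poly (\<Prod>b\<leftarrow>bs. [:- b, 1:]) (x - t)"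
  for t :: "'a :: comm_ring_1"
  by (induction bs) (simp_all add: algebra_simps)

text \<open>At \<open>y\<close> and \<open>z\<close> the factors \<open>[:0, 1:]\<close> of the two
  Laplacian polynomials evaluate to \<open>y\<close> and \<open>z\<close> and cancel in the
  pointwise identity. Both polynomials then agree off two points, hence everywhere.\<close>

lemma char_poly_supra_laplacian:
  fixes n m :: nat and c :: real
  assumes L1: "weighted_laplacian n L1" and L2: "weighted_laplacian m L2"
    and nm: "n \<ge> 1" "m \<ge> 1"
    and p1: "char_poly L1 = [:0, 1:] * (\<Prod>b\<leftarrow>bs1. [:- b, 1:])"
    and p2: "char_poly L2 = [:0, 1:] * (\<Prod>b\<leftarrow>bs2. [:- b, 1:])"
  shows "char_poly (supra_laplacian L1 L2 (uniform_coupling n m c)) = [:0, 1:] *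
    (\<Prod>b\<leftarrow>(1 / n + 1 / m) * c # map (\<lambda>b. b + c / n) bs1 @ map (\<lambda>b. b + c / m) bs2. [:- b, 1:])"
    (is "?p = ?q")
proof -
  have "poly ?p x = poly ?q x" if "x \<notin> {c / n, c / m}" for x
  proof -
    define y z where yz: "y = x - c / n" "z = x - c / m"
    have ne: "y \<noteq> 0" "z \<noteq> 0" using that by (auto simp: yz)
    define g where "g = (1 / n + 1 / m) * c"
    have "y * z * poly ?p x = y * z * poly ?q x"
      unfolding poly_char_poly_supra_laplacian[OF L1 L2 nm yz(1) ne(1) yz(2) ne(2)] p1 p2
      by (simp only: list.map prod_list.Cons map_append prod_list.append poly_mult
          poly_prod_linear_factors_shift g_def[symmetric] yz[symmetric]) (simp add: algebra_simps)
    with ne show ?thesis by simp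
  qed
  then have "- {c / n, c / m} \<subseteq> {x. poly (?p - ?q) x = 0}" by auto
  moreover have "infinite (- {c / n, c / m})"
    by (simp add: infinite_UNIV_char_0 Compl_eq_Diff_UNIV)
  ultimately have "infinite {x. poly (?p - ?q) x = 0}"
    using infinite_super by blast
  then show ?thesis
    using poly_roots_finite[of "?p - ?q"] by auto
qed

section \<open>Algebraic connectivity of the coupled graphs\<close>

lemma algebraic_connectivity_nonneg:
  assumes "weighted_laplacian n A" "n \<ge> 2"
  shows "0 \<le> algebraic_connectivity A"
proof -
  obtain bs where bs: "char_poly A = [:0, 1:] * (\<Prod>b\<leftarrow>bs. [:- b, 1:])"
    "\<And>b. b \<in> set bs \<Longrightarrow> 0 \<le> b" "length bs = n - 1"
    using weighted_laplacian_char_poly[OF assms(1)] assms(2) by auto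
  then have ne: "bs \<noteq> []" using assms(2) by auto
  show ?thesis
    using algebraic_connectivity_eq_Min[OF bs(1,2) ne] bs(2) ne by simp
qed

text \<open>For \<open>c \<ge> 0\<close> all listed roots stay nonnegative, so the second eigenvalue
  is their minimum; shifting a list by a constant shifts its minimum.\<close>

lemma algebraic_connectivity_supra_laplacian:
  fixes n m :: nat and c :: real
  assumes L1: "weighted_laplacian n L1" and L2: "weighted_laplacian m L2"
    and nm: "n \<ge> 2" "m \<ge> 2" and c: "c \<ge> 0"
  shows "algebraic_connectivity (supra_laplacian L1 L2 (uniform_coupling n m c))
    = Min {(1 / n + 1 / m) * c, algebraic_connectivity L1 + c / n, algebraic_connectivity L2 + c / m}"
proof -
  obtain bs1 where bs1: "char_poly L1 = [:0, 1:] * (\<Prod>b\<leftarrow>bs1. [:- b, 1:])"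
    "\<And>b. b \<in> set bs1 \<Longrightarrow> 0 \<le> b" "length bs1 = n - 1"
    using weighted_laplacian_char_poly[OF L1] nm by auto
  obtain bs2 where bs2: "char_poly L2 = [:0, 1:] * (\<Prod>b\<leftarrow>bs2. [:- b, 1:])"
    "\<And>b. b \<in> set bs2 \<Longrightarrow> 0 \<le> b" "length bs2 = m - 1"
    using weighted_laplacian_char_poly[OF L2] nm by auto
  have ne: "bs1 \<noteq> []" "bs2 \<noteq> []" using bs1(3) bs2(3) nm by auto
  have add: "Min ((\<lambda>b. b + t) ` set bs) = Min (set bs) + t" if "bs \<noteq> []" for bs and t :: real
    using that by (subst mono_Min_commute[symmetric]) (auto simp: mono_def)
  let ?bs = "(1 / n + 1 / m) * c # map (\<lambda>b. b + c / n) bs1 @ map (\<lambda>b. b + c / m) bs2"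
  have "algebraic_connectivity (supra_laplacian L1 L2 (uniform_coupling n m c)) = Min (set ?bs)"
    by (rule algebraic_connectivity_eq_Min[OF char_poly_supra_laplacian[OF L1 L2 _ _ bs1(1) bs2(1)]])
      (use nm c bs1(2) bs2(2) in \<open>auto intro!: add_nonneg_nonneg\<close>)
  also have "\<dots> = Min {(1 / n + 1 / m) * c, Min (set bs1) + c / n, Min (set bs2) + c / m}"
    using ne by (simp add: Min_Un add)
  also have "Min (set bs1) = algebraic_connectivity L1"
    using algebraic_connectivity_eq_Min[OF bs1(1,2)] ne by simp
  also have "Min (set bs2) = algebraic_connectivity L2"
    using algebraic_connectivity_eq_Min[OF bs2(1,2)] ne by simp
  finally show ?thesis .
qed

section \<open>The closed formula and its piecewise linear regimes in the coupling strength\<close>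

theorem mainTheorem5:
  fixes G1 :: "'a pair_pre_digraph" and G2 :: "'b pair_pre_digraph"
    and vs1 :: "'a list" and vs2 :: "'b list"
    and n m :: nat and L1 L2 :: "real mat" and L :: "real \<Rightarrow> real mat"
    and lam1 lam2 :: real
  assumes "pair_graph G1" and "Digraph_Component.connected (with_proj G1)"
    and "pair_graph G2" and "Digraph_Component.connected (with_proj G2)"
    and "vertex_enum G1 vs1" and "vertex_enum G2 vs2"
    and "n = card (pverts G1)" and "n \<ge> 2"
    and "m = card (pverts G2)" and "m \<ge> 2"
    and "L1 = laplacian G1 vs1" and "L2 = laplacian G2 vs2"
    and "lam1 = algebraic_connectivity L1" and "lam2 = algebraic_connectivity L2"
    and "\<And>c. L c = supra_laplacian L1 L2 (uniform_coupling n m c)"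
  shows "(\<forall>c\<ge>0. algebraic_connectivity (L c) =
            Min {(1 / real n + 1 / real m) * c, lam1 + c / real n, lam2 + c / real m})
    \<and> (n > m \<and> lam1 / real n > lam2 / real m \<longrightarrow>
        (let c_star = real n * lam2; c_starstar = inverse (1 / real m - 1 / real n) * (lam1 - lam2) in
          c_star < c_starstar
          \<and> (\<forall>c. 0 \<le> c \<and> c \<le> c_star \<longrightarrow>
               algebraic_connectivity (L c) = (1 / real n + 1 / real m) * c)
          \<and> (\<forall>c. c_star \<le> c \<and> c \<le> c_starstar \<longrightarrow> algebraic_connectivity (L c) = lam2 + c / real m)
          \<and> (\<forall>c\<ge>c_starstar. algebraic_connectivity (L c) = lam1 + c / real n)))
    \<and> (n > m \<and> lam1 > lam2 \<and> lam1 / real n < lam2 / real m \<longrightarrow>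
        (let c_star = real m * lam1 in
          (\<forall>c. 0 \<le> c \<and> c \<le> c_star \<longrightarrow>
             algebraic_connectivity (L c) = (1 / real n + 1 / real m) * c)
          \<and> (\<forall>c\<ge>c_star. algebraic_connectivity (L c) = lam1 + c / real n)))
    \<and> (n < m \<and> lam1 > lam2 \<longrightarrow>
        (let c_star = real n * lam2 in
          (\<forall>c. 0 \<le> c \<and> c \<le> c_star \<longrightarrow>
             algebraic_connectivity (L c) = (1 / real n + 1 / real m) * c)
          \<and> (\<forall>c\<ge>c_star. algebraic_connectivity (L c) = lam2 + c / real m)))
    \<and> (n = m \<longrightarrow>
        (let lam0 = min lam1 lam2; c_star = real n * lam0 in
          (\<forall>c. 0 \<le> c \<and> c \<le> c_star \<longrightarrow> algebraic_connectivity (L c) = 2 * c / real n)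
          \<and> (\<forall>c\<ge>c_star. algebraic_connectivity (L c) = lam0 + c / real n)))"
proof -
  have len: "length vs1 = n" "length vs2 = m"
    using assms(5-7,9) by (auto simp: vertex_enum_def simp flip: distinct_card)
  have wl: "weighted_laplacian n L1" "weighted_laplacian m L2"
    using weighted_laplacian_laplacian[OF assms(1,5)] weighted_laplacian_laplacian[OF assms(3,6)]
    by (simp_all add: len assms(11,12))
  have conn: "algebraic_connectivity (L c) =
      min ((1 / real n + 1 / real m) * c) (min (lam1 + c / real n) (lam2 + c / real m))"
    if "c \<ge> 0" for c
    using algebraic_connectivity_supra_laplacian[OF wl assms(8,10) that]
    by (simp add: assms(13-15))
  \<comment> \<open>This makes all thresholds nonnegative, so every \<open>c\<close> beyond one lies
    in the range \<open>c \<ge> 0\<close> of the formula.\<close>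
  have lam: "0 \<le> lam1" "0 \<le> lam2"
    using algebraic_connectivity_nonneg[OF wl(1) assms(8)]
      algebraic_connectivity_nonneg[OF wl(2) assms(10)] by (simp_all add: assms(13,14))
  have pos: "real n > 0" "real m > 0" using assms(8,10) by auto
  \<comment> \<open>Against the first branch, c/n cancels for \<open>lam1\<close> and c/m for
    \<open>lam2\<close>; the crossing points \<open>real m * lam1\<close> and
    \<open>real n * lam2\<close> are the candidates for c*.\<close>
  have cmp1: "(1 / real n + 1 / real m) * c \<le> lam1 + c / real n \<longleftrightarrow> c \<le> real m * lam1" for c
    using pos by (simp add: field_simps)
  have cmp2: "(1 / real n + 1 / real m) * c \<le> lam2 + c / real m \<longleftrightarrow> c \<le> real n * lam2" for c
    using pos by (simp add: field_simps)
  have cmp1': "lam1 + c / real n \<le> (1 / real n + 1 / real m) * c \<longleftrightarrow> real m * lam1 \<le> c" for c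
    using pos by (simp add: field_simps)
  have cmp2': "lam2 + c / real m \<le> (1 / real n + 1 / real m) * c \<longleftrightarrow> real n * lam2 \<le> c" for c
    using pos by (simp add: field_simps)
  have inv_le: "1 / real p \<le> 1 / real q" if "q < p" "0 < real q" for p q
    using that by (simp add: frac_le)
  have conn0: "algebraic_connectivity (L c) = (1 / real n + 1 / real m) * c"
    if "0 \<le> c" "c \<le> real m * lam1" "c \<le> real n * lam2" for c
    using that cmp1[of c] cmp2[of c] by (simp add: conn min.absorb1)
  have conn1: "algebraic_connectivity (L c) = lam1 + c / real n"
    if "real m * lam1 \<le> c" "lam1 + c / real n \<le> lam2 + c / real m" for c
  proof -
    have "0 \<le> real m * lam1" using lam by simp
    then show ?thesis using that cmp1'[of c] by (simp add: conn min.absorb1 min.absorb2)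
  qed
  have conn2: "algebraic_connectivity (L c) = lam2 + c / real m"
    if "real n * lam2 \<le> c" "lam2 + c / real m \<le> lam1 + c / real n" for c
  proof -
    have "0 \<le> real n * lam2" using lam by simp
    then show ?thesis using that cmp2'[of c] by (simp add: conn min.absorb1 min.absorb2)
  qed
  have formula: "\<forall>c\<ge>0. algebraic_connectivity (L c) =
      Min {(1 / real n + 1 / real m) * c, lam1 + c / real n, lam2 + c / real m}"
    by (simp add: conn)
  have case1: "let c_star = real n * lam2; c_starstar = inverse (1 / real m - 1 / real n) * (lam1 - lam2) in
      c_star < c_starstar
      \<and> (\<forall>c. 0 \<le> c \<and> c \<le> c_star \<longrightarrow>
           algebraic_connectivity (L c) = (1 / real n + 1 / real m) * c)
      \<and> (\<forall>c. c_star \<le> c \<and> c \<le> c_starstar \<longrightarrow> algebraic_connectivity (L c) = lam2 + c / real m)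
      \<and> (\<forall>c\<ge>c_starstar. algebraic_connectivity (L c) = lam1 + c / real n)"
    if "n > m" "lam1 / real n > lam2 / real m"
  proof -
    \<comment> \<open>\<open>d\<close> is the slope of the \<open>lam2\<close> branch minus that of
      the \<open>lam1\<close> branch, and \<open>t\<close>, the c** of the statement, is where the
      two cross.\<close>
    define d where "d = 1 / real m - 1 / real n"
    define t where "t = inverse d * (lam1 - lam2)"
    have d: "d > 0" using that pos by (simp add: d_def frac_less2)
    have lt: "real n * lam2 < real m * lam1" using that(2) pos by (simp add: field_simps)
    have div: "c / real m = d * c + c / real n" for c by (simp add: d_def algebra_simps)
    have cmp3: "lam2 + c / real m \<le> lam1 + c / real n \<longleftrightarrow> c \<le> t"
      "lam1 + c / real n \<le> lam2 + c / real m \<longleftrightarrow> t \<le> c" for c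
      unfolding div t_def using d by (auto simp: field_simps)
    \<comment> \<open>At \<open>real n * lam2\<close> the \<open>lam2\<close> branch is still
      strictly below the \<open>lam1\<close> branch, by \<open>lt\<close>, so their crossing comes
      later.\<close>
    have lt': "real n * lam2 < t"
    proof -
      have "lam2 + real n * lam2 / real m < lam1 + real n * lam2 / real n"
        using lt pos by (simp add: field_simps)
      then show ?thesis using cmp3(2)[of "real n * lam2"] by linarith
    qed
    have "algebraic_connectivity (L c) = lam1 + c / real n" if "t \<le> c" for c
    proof (rule conn1)
      \<comment> \<open>Beyond \<open>t\<close> the branches are ordered \<open>lam1\<close>,
        \<open>lam2\<close>, first branch from below; transitivity then yields
        \<open>real m * lam1 \<le> c\<close> without computing with \<open>t\<close>.\<close>
      have le: "lam1 + c / real n \<le> lam2 + c / real m" using cmp3(2) that by simp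
      also have "\<dots> \<le> (1 / real n + 1 / real m) * c" using cmp2' lt' that by simp
      finally show "real m * lam1 \<le> c" by (simp only: cmp1')
      show "lam1 + c / real n \<le> lam2 + c / real m" by (fact le)
    qed
    with lt lt' show ?thesis
      unfolding Let_def d_def[symmetric] t_def[symmetric]
      by (auto intro!: conn0 conn2 simp: cmp3)
  qed
  have case2: "let c_star = real m * lam1 in
      (\<forall>c. 0 \<le> c \<and> c \<le> c_star \<longrightarrow>
         algebraic_connectivity (L c) = (1 / real n + 1 / real m) * c)
      \<and> (\<forall>c\<ge>c_star. algebraic_connectivity (L c) = lam1 + c / real n)"
    if "n > m" "lam1 > lam2" "lam1 / real n < lam2 / real m"
  proof -
    have lt: "real m * lam1 < real n * lam2" using that(3) pos by (simp add: field_simps)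
    \<comment> \<open>The order holds at \<open>real m * lam1\<close> by \<open>lt\<close>, and
      persists because the \<open>lam2\<close> branch has the larger slope 1/m.\<close>
    have cmp3: "lam1 + c / real n \<le> lam2 + c / real m" if c: "real m * lam1 \<le> c" for c
    proof -
      have "lam1 + real m * lam1 / real n \<le> lam2 + real m * lam1 / real m"
        using lt pos by (simp add: field_simps)
      moreover have "(1 / real n) * (c - real m * lam1) \<le> (1 / real m) * (c - real m * lam1)"
        using c pos \<open>n > m\<close> by (intro mult_right_mono inv_le) auto
      ultimately show ?thesis by (simp add: diff_divide_distrib)
    qed
    show ?thesis
      unfolding Let_def using lt by (auto intro!: conn0 conn1 cmp3)
  qed
  have case3: "let c_star = real n * lam2 in
      (\<forall>c. 0 \<le> c \<and> c \<le> c_star \<longrightarrow>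
         algebraic_connectivity (L c) = (1 / real n + 1 / real m) * c)
      \<and> (\<forall>c\<ge>c_star. algebraic_connectivity (L c) = lam2 + c / real m)"
    if "n < m" "lam1 > lam2"
  proof -
    have le: "real n * lam2 \<le> real m * lam1"
      using that lam by (intro mult_mono) auto
    have c0: "0 \<le> real n * lam2" using lam by simp
    \<comment> \<open>The \<open>lam2\<close> branch has both the smaller intercept and the smaller
      slope, so the \<open>lam1\<close> branch never attains the minimum alone.\<close>
    have cmp3: "lam2 + c / real m \<le> lam1 + c / real n" if "0 \<le> c" for c
      using mult_right_mono[OF inv_le[OF \<open>n < m\<close> pos(1)] that] \<open>lam1 > lam2\<close> by simp
    show ?thesis
      unfolding Let_def using le by (auto intro!: conn0 conn2 cmp3 intro: order_trans[OF c0])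
  qed
  have equal: "let lam0 = min lam1 lam2; c_star = real n * lam0 in
      (\<forall>c. 0 \<le> c \<and> c \<le> c_star \<longrightarrow> algebraic_connectivity (L c) = 2 * c / real n)
      \<and> (\<forall>c\<ge>c_star. algebraic_connectivity (L c) = lam0 + c / real n)"
    if "n = m"
  proof -
    have c0: "0 \<le> real n * min lam1 lam2" using lam by simp
    \<comment> \<open>With equal sizes both shifted branches have slope 1/n and merge into one with
      intercept \<open>min lam1 lam2\<close>.\<close>
    have conn': "algebraic_connectivity (L c) = min (2 * c / real n) (min lam1 lam2 + c / real n)"
      if "c \<ge> 0" for c
      using conn[OF that] \<open>n = m\<close> by (simp add: min_def field_simps)
    have "2 * c / real n \<le> min lam1 lam2 + c / real n \<longleftrightarrow> c \<le> real n * min lam1 lam2"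
      "min lam1 lam2 + c / real n \<le> 2 * c / real n \<longleftrightarrow> real n * min lam1 lam2 \<le> c" for c
      using pos by (simp_all add: field_simps)
    with c0 show ?thesis
      unfolding Let_def by (auto simp: conn' min.absorb1 min.absorb2)
  qed
  show ?thesis
    using formula case1 case2 case3 equal by blast
qed

end
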